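(* Let $p$ be an odd prime, $k=1$, $r\ge2$ and $s=r-1\ge1$. For $0\le t\le p-1$ the $p^{(1)}$-Fibonacci numbers $\mathcal M_{s,1}(t)=\mathcal M\big(\lambda(2(s+1);(x_{(2s,1)},x_{(s,1)}+t))\big)$ are as follows. For $s=1$: $\mathcal M_{1,1}(t)=\frac{p-1}{2}$ for all $0\le t\le p-1$. For $s=2$: $$\mathcal M_{2,1}(t)=\begin{cases}\frac{p-1}{2}(2p+1),&0\le t<\frac{p-1}{2},\\[2pt] \frac{p-1}{2}(2p-1),&\frac{p-1}{2}\le t\le p-1.\end{cases}$$ For $s\ge3$: $$\mathcal M_{s,1}(t)=\begin{cases}\frac{p^{s-3}(p-1)}{2}\big(2(s-1)p^2+2t-(2s-5)\big),&0\le t<\frac{p-1}{2},\\[2pt] \frac{p^{s-3}(p-1)}{2}\big(2(s-1)p^2+2t-2p-(2s-5)\big),&\frac{p-1}{2}\le t\le p-1.\end{cases}$$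
   Context: Notation: $p$ is an odd prime, $k\ge0$, $r\ge1$ integers with $s=r-k\ge1$, $0\le l<p^k$; $x_{(a,k)}=p^k(ap-(a+1))$ for $a\ge1$. $\lambda(c;(n,i))$ denotes the hook partition $(n-i,1^i)$ of $n$, regarded as a vertex on floor $c$ of the $p$-Bratteli diagram. Paths. $P^{2r}_l$ is the set of all downward paths in the diagram from $\lambda(2r;(x_{(2s,k)},x_{(s,k)}+l))$ to floor $1$. Along a path, blocks $B(i;(m_i,n_i))$ ($m_i$ horizontal nodes and $n_i$ vertical nodes) are removed for $i=2r-1,2r-2,\dots,1$. Explicitly, a path $P$ is determined by arbitrary integers $u_s,u_{s-1},\dots,u_2\in\{0,\dots,p-1\}$ and $u_1\in\{0,\dots,p-2\}$ (distinct choices give distinct paths, and all paths arise). Put $L_s=l$ and, for $j=s,s-1,\dots,2$, $L'_j=L_j+p^ku_j$ and $L_{j-1}=\lfloor L'_j/p\rfloor$. The path visits $\lambda(2(k+j);(x_{(2j,k)},x_{(j,k)}+L_j))$ for $1\le j\le s$, $\lambda(2(k+j)-1;(x_{(2j-1,k)},x_{(j-1,k)}+L'_j))$ for $2\le j\le s$, and $\lambda(2k+1;(p^k(p-1),L_1+p^ku_1))$; below floor $2k+1$ the path is forced. The blocks are, for $2\le j\le s$, $$m_{2(k+j)-1}=p^ku_j,\quad n_{2(k+j)-1}=p^k(p-1-u_j),\quad n_{2(k+j)-2}=L'_j-\lfloor L'_j/p\rfloor,\quad m_{2(k+j)-2}=p^k(p-1)-n_{2(k+j)-2},$$ and $m_{2k+1}=p^ku_1$,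 $n_{2k+1}=p^k(p-2-u_1)$. Descents. For $2k+2\le i\le 2r-2$, $P$ has a descent at block $i$ if $m_i>m_{i+1}$ and $n_i<n_{i+1}$ (these blocks all have size $m_i+n_i=p^k(p-1)$). By convention $P$ has a descent at block $2k$ if and only if $u_1<\frac{p-1}{2}$, it has no descent at block $2k+1$, and none at blocks below $2k$. $\mathrm{des}(P)$ is the number of descents of $P$. The $p^{(k)}$-Fibonacci number of the vertex is $$\mathcal M_{s,k}(l):=\mathcal M\big(\lambda(2r;(x_{(2s,k)},x_{(s,k)}+l))\big)=\sum_{P\in P^{2r}_l}\mathrm{des}(P).$$ *)

theory Defs
  imports Complex_Main "HOL-Library.FuncSet" "HOL-Computational_Algebra.Primes"
begin

text \<open>
  Throughout, \<open>p\<close> is an odd prime, \<open>k \<ge> 0\<close>, \<open>s \<ge> 1\<close>, \<open>r = k + s\<close> and \<open>l < p ^ k\<close>.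
  In this range no natural-number subtraction below truncates; the sizes of removed blocks are
  integers, so that nothing is cut off there either.
\<close>

definition xnum :: "nat \<Rightarrow> nat \<Rightarrow> nat \<Rightarrow> nat" where
  "xnum p a k = p ^ k * (a * p - (a + 1))"

text \<open>A partition is the list of its parts in decreasing order; this is \<open>(n - i, 1, \<dots>, 1)\<close>.\<close>

definition hook :: "nat \<Rightarrow> nat \<Rightarrow> nat list" where
  "hook n i = (n - i) # replicate i 1"

text \<open>
  The choices \<open>u 1, \<dots>, u s\<close> determining a path that starts on floor \<open>2 * (k + s)\<close>.
\<close>

definition choices :: "nat \<Rightarrow> nat \<Rightarrow> (nat \<Rightarrow> nat) set" where
  "choices p s = (\<Pi>\<^sub>E j\<in>{1..s}. if j = 1 then {0..p - 2} else {0..p - 1})"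

text \<open>
  The numbers \<open>L\<^sub>j\<close> are given by a recursion that runs down from \<open>L\<^sub>s = l\<close>;
  \<open>Ldown \<dots> d\<close> is \<open>L\<^sub>s\<^sub>-\<^sub>d\<close>.
\<close>

primrec Ldown :: "nat \<Rightarrow> nat \<Rightarrow> nat \<Rightarrow> nat \<Rightarrow> (nat \<Rightarrow> nat) \<Rightarrow> nat \<Rightarrow> nat" where
  "Ldown p k s l u 0 = l"
| "Ldown p k s l u (Suc d) = (Ldown p k s l u d + p ^ k * u (s - d)) div p"

definition Lnum :: "nat \<Rightarrow> nat \<Rightarrow> nat \<Rightarrow> nat \<Rightarrow> (nat \<Rightarrow> nat) \<Rightarrow> nat \<Rightarrow> nat" where
  "Lnum p k s l u j = Ldown p k s l u (s - j)"

definition Lnum' :: "nat \<Rightarrow> nat \<Rightarrow> nat \<Rightarrow> nat \<Rightarrow> (nat \<Rightarrow> nat) \<Rightarrow> nat \<Rightarrow> nat" where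
  "Lnum' p k s l u j = Lnum p k s l u j + p ^ k * u j"

text \<open>
  A path maps every floor from \<open>2 * (k + s)\<close> down to \<open>2 * k + 1\<close> to the hook partition it visits
  there. Its continuation below floor \<open>2 * k + 1\<close> is forced and carries no information.
  Floors \<open>2 * (k + j)\<close> and \<open>2 * (k + j) - 1\<close> belong to the index \<open>j\<close>.
\<close>

definition hook_path ::
  "nat \<Rightarrow> nat \<Rightarrow> nat \<Rightarrow> nat \<Rightarrow> (nat \<Rightarrow> nat) \<Rightarrow> nat \<Rightarrow> nat list" where
  "hook_path p k s l u = restrict
     (\<lambda>c. if c = 2 * k + 1 then hook (p ^ k * (p - 1)) (Lnum p k s l u 1 + p ^ k * u 1)
          else if even c then
            (let j = c div 2 - k in hook (xnum p (2 * j) k) (xnum p j k + Lnum p k s l u j))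
          else
            (let j = (c + 1) div 2 - k
             in hook (xnum p (2 * j - 1) k) (xnum p (j - 1) k + Lnum' p k s l u j)))
     {2 * k + 1..2 * (k + s)}"

definition hook_paths :: "nat \<Rightarrow> nat \<Rightarrow> nat \<Rightarrow> nat \<Rightarrow> (nat \<Rightarrow> nat list) set" where
  "hook_paths p k s l = hook_path p k s l ` choices p s"

text \<open>
  Block \<open>i\<close> is what is removed in passing from floor \<open>i + 1\<close> to floor \<open>i\<close>: horizontal nodes come
  off the first row and vertical nodes off the first column.
\<close>

definition horiz :: "(nat \<Rightarrow> nat list) \<Rightarrow> nat \<Rightarrow> int" where
  "horiz P i = int (hd (P (i + 1))) - int (hd (P i))"

definition vert :: "(nat \<Rightarrow> nat list) \<Rightarrow> nat \<Rightarrow> int" where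
  "vert P i = int (length (P (i + 1))) - int (length (P i))"

text \<open>
  At block \<open>2 * k\<close> the convention is that there is a descent iff \<open>u 1 < (p - 1) / 2\<close>;
  the quotient below is \<open>u 1\<close>, by \<open>horiz_bottom\<close> further down.
\<close>

definition descent_at :: "nat \<Rightarrow> nat \<Rightarrow> nat \<Rightarrow> (nat \<Rightarrow> nat list) \<Rightarrow> nat \<Rightarrow> bool" where
  "descent_at p k s P i \<longleftrightarrow>
     (if i = 2 * k then real_of_int (horiz P (2 * k + 1)) / real p ^ k < (real p - 1) / 2
      else 2 * k + 2 \<le> i \<and> i \<le> 2 * (k + s) - 2 \<and>
           horiz P i > horiz P (i + 1) \<and> vert P i < vert P (i + 1))"

definition des :: "nat \<Rightarrow> nat \<Rightarrow> nat \<Rightarrow> (nat \<Rightarrow> nat list) \<Rightarrow> nat" where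
  "des p k s P = card {i. descent_at p k s P i}"

text \<open>
  The \<open>p\<^sup>(\<^sup>k\<^sup>)\<close>-Fibonacci number of the vertex
  \<open>hook (xnum p (2 * s) k) (xnum p s k + l)\<close> on floor \<open>2 * (k + s)\<close>.
\<close>

definition fib_num :: "nat \<Rightarrow> nat \<Rightarrow> nat \<Rightarrow> nat \<Rightarrow> nat" where
  "fib_num p k s l = (\<Sum>P\<in>hook_paths p k s l. des p k s P)"


lemma xnum_int:
  assumes "3 \<le> p" "1 \<le> a"
  shows "int (xnum p a k) = int p ^ k * (int a * (int p - 1) - 1)"
proof -
  have "a * 3 \<le> a * p"
    using assms by (intro mult_left_mono) auto
  then have "a + 1 \<le> a * p"
    using assms by linarith
  then have "int (a * p - (a + 1)) = int (a * p) - int (a + 1)"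
    by (rule of_nat_diff)
  then have "int (a * p - (a + 1)) = int a * (int p - 1) - 1"
    by (simp add: algebra_simps)
  then show ?thesis
    by (simp add: xnum_def)
qed

lemma choices_le:
  assumes "u \<in> choices p s" "1 \<le> j" "j \<le> s"
  shows "u j \<le> p - 1" and "u 1 \<le> p - 2"
proof -
  have *: "u i \<in> (if i = 1 then {0..p - 2} else {0..p - 1})" if "i \<in> {1..s}" for i
    using assms(1) that unfolding choices_def by (rule PiE_mem)
  have "1 \<in> {1..s}" "j \<in> {1..s}" using assms by auto
  from *[OF this(1)] *[OF this(2)] show "u j \<le> p - 1" "u 1 \<le> p - 2"
    by (auto split: if_splits)
qed

lemma Lnum_top: "Lnum p k s l u s = l"
  by (simp add: Lnum_def)

lemma Lnum_step:
  assumes "2 \<le> j" "j \<le> s"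
  shows "Lnum p k s l u (j - 1) = Lnum' p k s l u j div p"
proof -
  have "s - (j - 1) = Suc (s - j)" "s - (s - j) = j"
    using assms by auto
  then show ?thesis
    by (simp add: Lnum_def Lnum'_def)
qed

lemma Lnum'_less_if:
  assumes "u \<in> choices p s" "3 \<le> p" "1 \<le> j" "j \<le> s" "Lnum p k s l u j < p ^ k"
  shows "Lnum' p k s l u j < p ^ k * p"
proof -
  have "p ^ k * u j \<le> p ^ k * (p - 1)"
    using choices_le(1)[OF assms(1,3,4)] by simp
  also have "\<dots> + p ^ k = p ^ k * p"
    using assms(2) by (simp add: algebra_simps flip: mult_Suc_right)
  ultimately show ?thesis
    using assms(5) unfolding Lnum'_def by linarith
qed

lemma Lnum_less:
  assumes "u \<in> choices p s" "3 \<le> p" "l < p ^ k" "1 \<le> j" "j \<le> s"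
  shows "Lnum p k s l u j < p ^ k"
  using assms(5,4)
proof (induction rule: inc_induct)
  case base
  then show ?case using assms by (simp add: Lnum_top)
next
  case (step i)
  have "Lnum' p k s l u (Suc i) < p ^ k * p"
    using step assms by (intro Lnum'_less_if) auto
  then have "Lnum' p k s l u (Suc i) div p < p ^ k"
    using assms by (simp add: less_mult_imp_div_less)
  then show ?case
    using Lnum_step[of "Suc i" s p k l u] step by simp
qed

lemma Lnum'_less:
  assumes "u \<in> choices p s" "3 \<le> p" "l < p ^ k" "1 \<le> j" "j \<le> s"
  shows "Lnum' p k s l u j < p ^ k * p"
  using Lnum'_less_if[OF assms(1,2,4,5) Lnum_less[OF assms]] .

lemma hook_path_even:
  assumes "1 \<le> j" "j \<le> s"
  shows "hook_path p k s l u (2 * (k + j)) =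
         hook (xnum p (2 * j) k) (xnum p j k + Lnum p k s l u j)"
proof -
  have "2 * (k + j) \<noteq> 2 * k + 1" by presburger
  then show ?thesis using assms by (simp add: hook_path_def Let_def)
qed

lemma hook_path_odd:
  assumes "2 \<le> j" "j \<le> s"
  shows "hook_path p k s l u (2 * (k + j) - 1) =
         hook (xnum p (2 * j - 1) k) (xnum p (j - 1) k + Lnum' p k s l u j)"
proof -
  have "2 * (k + j) - 1 \<noteq> 2 * k + 1" "odd (2 * (k + j) - 1)" "2 * (k + j) - 1 + 1 = 2 * (k + j)"
    "2 * (k + j) - 1 \<in> {2 * k + 1..2 * (k + s)}"
    using assms by auto
  moreover have "2 * (k + j) div 2 - k = j" by simp
  ultimately show ?thesis unfolding hook_path_def Let_def by (simp only: restrict_apply if_True if_False)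
qed

lemma hook_path_bottom:
  assumes "1 \<le> s"
  shows "hook_path p k s l u (2 * k + 1) =
         hook (p ^ k * (p - 1)) (Lnum p k s l u 1 + p ^ k * u 1)"
  using assms by (simp add: hook_path_def)

lemma hook_path_start:
  assumes "1 \<le> s"
  shows "hook_path p k s l u (2 * (k + s)) = hook (xnum p (2 * s) k) (xnum p s k + l)"
  using hook_path_even[of s s] assms by (simp add: Lnum_top)

lemma hook_simps: "i \<le> n \<Longrightarrow> int (hd (hook n i)) = int n - int i" "length (hook n i) = Suc i"
  by (simp_all add: hook_def)

lemma hook_is_partition: "i \<le> n \<Longrightarrow> sum_list (hook n i) = n"
  by (simp add: hook_def sum_list_replicate)

lemma hook_legs_less_even:
  assumes "3 \<le> p" "1 \<le> j" "L < p ^ k"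
  shows "xnum p j k + L < xnum p (2 * j) k"
proof -
  have "int (xnum p (2 * j) k) - int (xnum p j k) = int p ^ k * (int j * (int p - 1))"
    using assms by (simp add: xnum_int algebra_simps)
  moreover have "int p ^ k * 1 \<le> int p ^ k * (int j * (int p - 1))"
    using assms mult_mono[of 1 "int j" 1 "int p - 1"] by (intro mult_left_mono) auto
  moreover have "int L < int p ^ k"
    using assms by (simp flip: of_nat_power)
  ultimately show ?thesis by linarith
qed

lemma hook_legs_less_odd:
  assumes "3 \<le> p" "2 \<le> j" "L' < p ^ k * p"
  shows "xnum p (j - 1) k + L' < xnum p (2 * j - 1) k"
proof -
  have "int (xnum p (2 * j - 1) k) - int (xnum p (j - 1) k) = int p ^ k * (int j * (int p - 1))"
    using assms by (simp add: xnum_int of_nat_diff algebra_simps)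
  moreover have "int p ^ k * int p \<le> int p ^ k * (int j * (int p - 1))"
  proof (rule mult_left_mono)
    have "2 * (int p - 1) \<le> int j * (int p - 1)"
      using assms by (intro mult_right_mono) auto
    moreover have "int p \<le> 2 * (int p - 1)" using assms by simp
    ultimately show "int p \<le> int j * (int p - 1)" by (rule order_trans[rotated])
  qed auto
  moreover have "int L' < int p ^ k * int p"
    using assms by (simp flip: of_nat_power of_nat_mult)
  ultimately show ?thesis by linarith
qed

lemma hook_legs_less_bottom:
  assumes "u \<in> choices p s" "3 \<le> p" "l < p ^ k" "1 \<le> s"
  shows "Lnum p k s l u 1 + p ^ k * u 1 < p ^ k * (p - 1)"
proof -
  have "Lnum p k s l u 1 < p ^ k"
    using assms by (intro Lnum_less) auto
  moreover have "p ^ k * u 1 \<le> p ^ k * (p - 2)"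
    using choices_le(2)[OF assms(1) le_refl assms(4)] by simp
  moreover have "p ^ k * (p - 1) = p ^ k * (p - 2) + p ^ k"
  proof -
    have "p - 1 = Suc (p - 2)" using assms by simp
    then show ?thesis by (metis add.commute mult_Suc_right)
  qed
  ultimately show ?thesis by linarith
qed

lemma blocks_odd:
  assumes "u \<in> choices p s" "3 \<le> p" "l < p ^ k" "2 \<le> j" "j \<le> s"
  defines "P \<equiv> hook_path p k s l u"
  shows "horiz P (2 * (k + j) - 1) = int p ^ k * int (u j)"
    and "vert P (2 * (k + j) - 1) = int p ^ k * (int p - 1 - int (u j))"
proof -
  have floor: "2 * (k + j) - 1 + 1 = 2 * (k + j)" using assms by simp
  have L: "Lnum p k s l u j < p ^ k" and L': "Lnum' p k s l u j < p ^ k * p"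
    using assms by (auto intro!: Lnum_less Lnum'_less)
  have top: "P (2 * (k + j)) = hook (xnum p (2 * j) k) (xnum p j k + Lnum p k s l u j)"
    unfolding P_def using assms by (intro hook_path_even) auto
  have bot: "P (2 * (k + j) - 1) =
      hook (xnum p (2 * j - 1) k) (xnum p (j - 1) k + Lnum' p k s l u j)"
    unfolding P_def using assms by (intro hook_path_odd) auto
  have le: "xnum p j k + Lnum p k s l u j \<le> xnum p (2 * j) k"
    "xnum p (j - 1) k + Lnum' p k s l u j \<le> xnum p (2 * j - 1) k"
    using hook_legs_less_even[of p j _ k] hook_legs_less_odd[of p j _ k] assms L L'
    by (auto intro: less_imp_le)
  show "horiz P (2 * (k + j) - 1) = int p ^ k * int (u j)"
    unfolding horiz_def floor top bot hook_simps(1)[OF le(1)] hook_simps(1)[OF le(2)]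
    using assms by (simp add: xnum_int Lnum'_def of_nat_diff algebra_simps)
  show "vert P (2 * (k + j) - 1) = int p ^ k * (int p - 1 - int (u j))"
    unfolding vert_def floor top bot hook_simps(2)
    using assms by (simp add: xnum_int Lnum'_def of_nat_diff algebra_simps)
qed

lemma blocks_even:
  assumes "u \<in> choices p s" "3 \<le> p" "l < p ^ k" "2 \<le> j" "j \<le> s"
  defines "P \<equiv> hook_path p k s l u" and "L' \<equiv> Lnum' p k s l u j"
  shows "vert P (2 * (k + j) - 2) = int L' - int (L' div p)"
    and "horiz P (2 * (k + j) - 2) = int p ^ k * (int p - 1) - (int L' - int (L' div p))"
proof -
  have floor: "2 * (k + j) - 2 + 1 = 2 * (k + j) - 1" "2 * (k + j) - 2 = 2 * (k + (j - 1))"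
    using assms by auto
  have step: "Lnum p k s l u (j - 1) = L' div p"
    unfolding L'_def using assms by (intro Lnum_step) auto
  have L: "L' div p < p ^ k" and L': "L' < p ^ k * p"
    using Lnum_less[of u p s l k "j - 1"] Lnum'_less[of u p s l k j] assms step by auto
  have top: "P (2 * (k + j) - 1) = hook (xnum p (2 * j - 1) k) (xnum p (j - 1) k + L')"
    unfolding P_def L'_def using assms by (intro hook_path_odd) auto
  have bot: "P (2 * (k + (j - 1))) = hook (xnum p (2 * (j - 1)) k) (xnum p (j - 1) k + L' div p)"
    unfolding P_def step[symmetric] using assms by (intro hook_path_even) auto
  have le: "xnum p (j - 1) k + L' \<le> xnum p (2 * j - 1) k"
    "xnum p (j - 1) k + L' div p \<le> xnum p (2 * (j - 1)) k"
    using hook_legs_less_even[of p "j - 1" _ k] hook_legs_less_odd[of p j _ k] assms(1-5) L L'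
    by (auto intro: less_imp_le)
  show "vert P (2 * (k + j) - 2) = int L' - int (L' div p)"
    unfolding vert_def floor(1) unfolding floor(2) top bot hook_simps(2) by simp
  show "horiz P (2 * (k + j) - 2) = int p ^ k * (int p - 1) - (int L' - int (L' div p))"
    unfolding horiz_def floor(1) unfolding floor(2) top bot
      hook_simps(1)[OF le(1)] hook_simps(1)[OF le(2)]
    using assms(2,4) by (simp add: xnum_int of_nat_diff algebra_simps)
qed

lemma
  assumes "u \<in> choices p s" "3 \<le> p" "l < p ^ k" "1 \<le> s"
  defines "P \<equiv> hook_path p k s l u"
  shows horiz_bottom: "horiz P (2 * k + 1) = int p ^ k * int (u 1)"
    and vert_bottom: "vert P (2 * k + 1) = int p ^ k * (int p - 2 - int (u 1))"
proof -
  have floor: "2 * k + 1 + 1 = 2 * (k + 1)" by simp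
  have L: "Lnum p k s l u 1 < p ^ k"
    using assms by (intro Lnum_less) auto
  have top: "P (2 * (k + 1)) = hook (xnum p (2 * 1) k) (xnum p 1 k + Lnum p k s l u 1)"
    unfolding P_def using assms by (intro hook_path_even) auto
  have bot: "P (2 * k + 1) = hook (p ^ k * (p - 1)) (Lnum p k s l u 1 + p ^ k * u 1)"
    unfolding P_def using assms by (intro hook_path_bottom) auto
  have le: "xnum p 1 k + Lnum p k s l u 1 \<le> xnum p (2 * 1) k"
    "Lnum p k s l u 1 + p ^ k * u 1 \<le> p ^ k * (p - 1)"
    using hook_legs_less_even[of p 1 _ k] hook_legs_less_bottom[of u p s l k] assms L
    by (auto intro: less_imp_le)
  show "horiz P (2 * k + 1) = int p ^ k * int (u 1)"
    unfolding horiz_def floor top bot hook_simps(1)[OF le(1)] hook_simps(1)[OF le(2)]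
    using assms by (simp add: xnum_int of_nat_diff algebra_simps)
  show "vert P (2 * k + 1) = int p ^ k * (int p - 2 - int (u 1))"
    unfolding vert_def floor top bot hook_simps(2)
    using assms by (simp add: xnum_int of_nat_diff algebra_simps)
qed

lemma inj_on_hook_path:
  assumes "3 \<le> p" "l < p ^ k" "1 \<le> s"
  shows "inj_on (hook_path p k s l) (choices p s)"
proof (rule inj_onI)
  fix u v assume u: "u \<in> choices p s" and v: "v \<in> choices p s"
    and eq: "hook_path p k s l u = hook_path p k s l v"
  have "u j = v j" if "j \<in> {1..s}" for j
  proof (cases "j = 1")
    case True
    then show ?thesis
      using horiz_bottom[OF u assms] horiz_bottom[OF v assms] eq assms by auto
  next
    case False
    then have j: "2 \<le> j" "j \<le> s" using that by auto
    show ?thesis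
      using blocks_odd(1)[OF u assms(1,2) j] blocks_odd(1)[OF v assms(1,2) j] eq assms by auto
  qed
  then show "u = v"
    using u v unfolding choices_def by (meson PiE_ext)
qed

end

theory Submission
  imports Defs
begin

text \<open>
  For \<open>k = 1\<close> every \<open>L\<^sub>j\<close> is less than \<open>p\<close>, so \<open>L\<^sub>j\<^sub>-\<^sub>1 = u\<^sub>j\<close> and whether a block is a descent
  depends on at most three consecutive choices, where \<open>t\<close> plays the part of \<open>u\<^sub>s\<^sub>+\<^sub>1\<close>. The
  Fibonacci number is obtained by summing, for each block, the number of choices that produce a
  descent there; only the two blocks whose condition involves \<open>t\<close> depend on \<open>t\<close>.
\<close>

section \<open>Sums over function spaces whose summand depends on few coordinates\<close>

lemma sum_PiE_split:
  assumes "i \<in> I"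
  shows "(\<Sum>u\<in>Pi\<^sub>E I F. g u) = (\<Sum>x\<in>F i. \<Sum>v\<in>Pi\<^sub>E (I - {i}) F. g (v(i := x)))"
proof -
  have "Pi\<^sub>E I F = (\<lambda>(y, v). v(i := y)) ` (F i \<times> Pi\<^sub>E (I - {i}) F)"
    using PiE_insert_eq[of i "I - {i}" F] assms by (simp add: insert_absorb)
  moreover have "inj_on (\<lambda>(y, v). v(i := y)) (F i \<times> Pi\<^sub>E (I - {i}) F)"
    by (intro inj_combinator) simp
  ultimately show ?thesis
    by (simp add: sum.reindex sum.cartesian_product split_def)
qed

text \<open>Off coordinate \<open>i\<close> the summand is constant, so each value there is weighted
  by the number of functions on \<open>I - {i}\<close>.\<close>

lemma sum_PiE_coord1:
  fixes f :: "'b \<Rightarrow> nat"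
  assumes "i \<in> I"
  shows "(\<Sum>u\<in>Pi\<^sub>E I F. f (u i)) = card (Pi\<^sub>E (I - {i}) F) * (\<Sum>x\<in>F i. f x)"
  by (simp add: sum_PiE_split[OF assms] sum_distrib_left)

text \<open>Coordinate \<open>j\<close> is split off first, and the one-coordinate case applies for
  each value of it. The sum over \<open>F i\<close> stays innermost because descents are later
  counted over the lowest index first.\<close>

lemma sum_PiE_coord2:
  fixes f :: "'b \<Rightarrow> 'b \<Rightarrow> nat"
  assumes "i \<in> I" "j \<in> I" "i \<noteq> j"
  shows "(\<Sum>u\<in>Pi\<^sub>E I F. f (u i) (u j)) =
         card (Pi\<^sub>E (I - {i, j}) F) * (\<Sum>y\<in>F j. \<Sum>x\<in>F i. f x y)"
proof -
  have *: "I - {j} - {i} = I - {i, j}" by auto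
  have "(\<Sum>u\<in>Pi\<^sub>E I F. f (u i) (u j)) = (\<Sum>y\<in>F j. \<Sum>v\<in>Pi\<^sub>E (I - {j}) F. f (v i) y)"
    using assms by (simp add: sum_PiE_split[of j])
  also have "\<dots> = (\<Sum>y\<in>F j. card (Pi\<^sub>E (I - {j} - {i}) F) * (\<Sum>x\<in>F i. f x y))"
    using assms by (intro sum.cong refl sum_PiE_coord1) auto
  finally show ?thesis by (simp add: * sum_distrib_left)
qed

lemma sum_PiE_coord3:
  fixes f :: "'b \<Rightarrow> 'b \<Rightarrow> 'b \<Rightarrow> nat"
  assumes "i \<in> I" "j \<in> I" "m \<in> I" "i \<noteq> j" "i \<noteq> m" "j \<noteq> m"
  shows "(\<Sum>u\<in>Pi\<^sub>E I F. f (u i) (u j) (u m)) =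
         card (Pi\<^sub>E (I - {i, j, m}) F) * (\<Sum>z\<in>F m. \<Sum>y\<in>F j. \<Sum>x\<in>F i. f x y z)"
proof -
  have *: "I - {m} - {i, j} = I - {i, j, m}" by auto
  have "(\<Sum>u\<in>Pi\<^sub>E I F. f (u i) (u j) (u m)) =
      (\<Sum>z\<in>F m. \<Sum>v\<in>Pi\<^sub>E (I - {m}) F. f (v i) (v j) z)"
    using assms by (simp add: sum_PiE_split[of m])
  also have "\<dots> = (\<Sum>z\<in>F m. card (Pi\<^sub>E (I - {m} - {i, j}) F) * (\<Sum>y\<in>F j. \<Sum>x\<in>F i. f x y z))"
    using assms by (intro sum.cong refl sum_PiE_coord2) auto
  finally show ?thesis by (simp add: * sum_distrib_left)
qed

section \<open>Numbers of choices with prescribed coordinates\<close>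

abbreviation choice_range :: "nat \<Rightarrow> nat \<Rightarrow> nat set" where
  "choice_range p j \<equiv> if j = 1 then {0..p - 2} else {0..p - 1}"

lemma choice_range_eq: "2 \<le> j \<Longrightarrow> 1 \<le> p \<Longrightarrow> choice_range p j = {..<p}"
  by auto

text \<open>The removed set \<open>J\<close> avoids 1, so coordinate 1 keeps its
  \<open>p - 1\<close> values and each of the other \<open>s - 1 - card J\<close> free coordinates
  has \<open>p\<close>.\<close>

lemma card_choices_off:
  assumes "2 \<le> p" "1 \<le> s" "J \<subseteq> {2..s}"
  shows "card (Pi\<^sub>E ({1..s} - J) (choice_range p)) = (p - 1) * p ^ (s - 1 - card J)"
proof -
  have fin: "finite J" using assms(3) finite_subset by blast
  have "{1..s} - J = insert 1 ({2..s} - J)" using assms by auto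
  then have "card (Pi\<^sub>E ({1..s} - J) (choice_range p)) =
      card (choice_range p 1) * (\<Prod>j\<in>{2..s} - J. card (choice_range p j))"
    by (simp add: card_PiE)
  also have "(\<Prod>j\<in>{2..s} - J. card (choice_range p j)) = (\<Prod>j\<in>{2..s} - J. p)"
    using assms by (intro prod.cong) auto
  also have "\<dots> = p ^ (s - 1 - card J)"
    using assms fin by (simp add: card_Diff_subset)
  also have "card (choice_range p 1) = p - 1" using assms by simp
  finally show ?thesis .
qed

lemma choices_eq: "choices p s = Pi\<^sub>E {1..s} (choice_range p)"
  by (simp add: choices_def)

text \<open>Treated apart because fixing coordinate 1 removes the one short range: the remaining
  \<open>s - 1\<close> coordinates all have \<open>p\<close> values.\<close>

lemma sum_choices_first:
  assumes "2 \<le> p" "1 \<le> s"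
  shows "(\<Sum>u\<in>choices p s. f (u 1)) = p ^ (s - 1) * (\<Sum>x<p - 1. f x :: nat)"
proof -
  have "card (Pi\<^sub>E ({1..s} - {1}) (choice_range p)) = (\<Prod>j\<in>{1..s} - {1}. p)"
    unfolding card_PiE[OF finite_Diff[OF finite_atLeastAtMost]]
    using assms by (intro prod.cong) auto
  also have "\<dots> = p ^ (s - 1)" using assms by simp
  finally have c: "card (Pi\<^sub>E ({1..s} - {1}) (choice_range p)) = p ^ (s - 1)" .
  have "choice_range p 1 = {..<p - 1}" using assms by auto
  then show ?thesis
    unfolding choices_eq using assms c by (subst sum_PiE_coord1) auto
qed

lemma sum_choices_coord1:
  assumes "2 \<le> p" "2 \<le> i" "i \<le> s"
  shows "(\<Sum>u\<in>choices p s. f (u i)) = (p - 1) * p ^ (s - 2) * (\<Sum>x<p. f x :: nat)"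
proof -
  have "card (Pi\<^sub>E ({1..s} - {i}) (choice_range p)) = (p - 1) * p ^ (s - 2)"
    using assms by (subst card_choices_off) auto
  then show ?thesis
    unfolding choices_eq using assms
    by (subst sum_PiE_coord1) (simp_all only: choice_range_eq, auto)
qed

lemma sum_choices_coord2:
  assumes "2 \<le> p" "2 \<le> i" "i < s"
  shows "(\<Sum>u\<in>choices p s. f (u i) (u (Suc i))) =
         (p - 1) * p ^ (s - 3) * (\<Sum>y<p. \<Sum>x<p. f x y :: nat)"
proof -
  have c: "card (Pi\<^sub>E ({1..s} - {i, Suc i}) (choice_range p)) = (p - 1) * p ^ (s - 3)"
    using assms by (subst card_choices_off) auto
  have r: "choice_range p i = {..<p}" "choice_range p (Suc i) = {..<p}"
    using assms by (simp_all only: choice_range_eq)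
  have "i \<in> {1..s}" "Suc i \<in> {1..s}" "i \<noteq> Suc i" using assms by auto
  from sum_PiE_coord2[OF this, of f "choice_range p"] show ?thesis
    unfolding choices_eq c r .
qed

text \<open>The bounds on \<open>i\<close> force \<open>4 \<le> s\<close>, so the exponent
  \<open>s - 4\<close> is not truncated.\<close>

lemma sum_choices_coord3:
  assumes "2 \<le> p" "2 \<le> i" "Suc i < s"
  shows "(\<Sum>u\<in>choices p s. f (u i) (u (Suc i)) (u (Suc (Suc i)))) =
         (p - 1) * p ^ (s - 4) * (\<Sum>z<p. \<Sum>y<p. \<Sum>x<p. f x y z :: nat)"
proof -
  have c: "card (Pi\<^sub>E ({1..s} - {i, Suc i, Suc (Suc i)}) (choice_range p)) = (p - 1) * p ^ (s - 4)"
    using assms by (subst card_choices_off) auto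
  have r: "choice_range p i = {..<p}" "choice_range p (Suc i) = {..<p}"
    "choice_range p (Suc (Suc i)) = {..<p}"
    using assms by (simp_all only: choice_range_eq)
  have "i \<in> {1..s}" "Suc i \<in> {1..s}" "Suc (Suc i) \<in> {1..s}" "i \<noteq> Suc i" "i \<noteq> Suc (Suc i)"
    "Suc i \<noteq> Suc (Suc i)" using assms by auto
  from sum_PiE_coord3[OF this, of f "choice_range p"] show ?thesis
    unfolding choices_eq c r .
qed

section \<open>Descent conditions for k = 1 and the descents of one path\<close>

lemma Lnum_1:
  assumes "u \<in> choices p s" "3 \<le> p" "l < p" "1 \<le> j" "j \<le> s"
  shows "Lnum p 1 s l u j = (if j = s then l else u (Suc j))"
proof (cases "j = s")
  case False
  \<comment> \<open>By this bound \<open>Lnum\<close> and \<open>u (Suc j)\<close> are the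
    base-\<open>p\<close> digits of \<open>Lnum'\<close> at \<open>Suc j\<close>, and division by
    \<open>p\<close> keeps the latter.\<close>
  have "Lnum p 1 s l u (Suc j) < p"
    using Lnum_less[of u p s l 1 "Suc j"] assms False by simp
  then show ?thesis
    using Lnum_step[of "Suc j" s p 1 l u] assms False by (simp add: Lnum'_def)
qed (simp add: Lnum_top)

text \<open>In use \<open>h\<close> is (p - 1) / 2 and \<open>x\<close>, \<open>y\<close> are
  \<open>u\<^sub>j\<close>, \<open>u\<^sub>j\<^sub>+\<^sub>1\<close>: the two-digit
  base-\<open>p\<close> number with digits \<open>x\<close>, \<open>y\<close> lies below the one
  with digits \<open>h\<close>, \<open>h\<close>.\<close>

definition even_descent :: "nat \<Rightarrow> nat \<Rightarrow> nat \<Rightarrow> bool" where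
  "even_descent h x y \<longleftrightarrow> x < h \<or> x = h \<and> y < h"

text \<open>The arguments are \<open>u\<^sub>j\<close>, \<open>u\<^sub>j\<^sub>+\<^sub>1\<close>,
  \<open>u\<^sub>j\<^sub>+\<^sub>2\<close>; the third only breaks the tie x + y = p - 1.\<close>

definition odd_descent :: "nat \<Rightarrow> nat \<Rightarrow> nat \<Rightarrow> nat \<Rightarrow> bool" where
  "odd_descent p x y z \<longleftrightarrow> p \<le> x + y + of_bool (y < z)"

text \<open>The two sides differ by 2p(h - x) + (x - y) with |x - y| < p, so h - x decides the sign
  unless it vanishes.\<close>

lemma even_descent_iff:
  fixes x y h :: nat
  assumes "p = 2 * h + 1" "y < p" "x < p"
  shows "int y + (int p - 1) * int x < int p * (int p - 1 - int x) \<longleftrightarrow> even_descent h x y"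
proof -
  have eq: "int p * (int p - 1 - int x) - (int y + (int p - 1) * int x) =
      2 * int p * (int h - int x) + (int x - int y)"
    using assms(1) by (simp add: algebra_simps)
  consider "x < h" | "x = h" | "x > h" by linarith
  then show ?thesis
  proof cases
    case 1
    then have "2 * int p * 1 \<le> 2 * int p * (int h - int x)" by (intro mult_left_mono) auto
    then show ?thesis using eq 1 assms unfolding even_descent_def by linarith
  next
    case 2
    then show ?thesis using eq unfolding even_descent_def by auto
  next
    case 3
    then have "2 * int p * (int h - int x) \<le> 2 * int p * (-1)" by (intro mult_left_mono) auto
    then show ?thesis using eq 3 assms unfolding even_descent_def by linarith
  qed
qed

text \<open>The same separation of scales: the difference is (z - y) - pq with |z - y| < p, so the
  sign of q decides unless q = 0.\<close>

lemma odd_descent_iff: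
  fixes x y z :: nat
  assumes "z < p" "y < p"
  shows "int p * (int p - 1 - int x) < int z + (int p - 1) * int y \<longleftrightarrow> odd_descent p x y z"
proof -
  define q where "q = int p - 1 - int x - int y"
  have eq: "int z + (int p - 1) * int y - int p * (int p - 1 - int x) =
      (int z - int y) - int p * q"
    by (simp add: q_def algebra_simps)
  consider "q < 0" | "q = 0" | "q > 0" by linarith
  then show ?thesis
  proof cases
    case 1
    then have "int p * q \<le> int p * (-1)" by (intro mult_left_mono) auto
    moreover have "p \<le> x + y" using 1 unfolding q_def by linarith
    ultimately show ?thesis using eq assms unfolding odd_descent_def by auto
  next
    case 2
    then have "x + y + 1 = p" unfolding q_def by linarith
    then show ?thesis using eq 2 unfolding odd_descent_def by (auto simp: of_bool_def)
  next
    case 3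
    then have "int p * 1 \<le> int p * q" by (intro mult_left_mono) auto
    then have "\<not> int p * (int p - 1 - int x) < int z + (int p - 1) * int y"
      using eq assms by linarith
    moreover have "x + y + 1 < p" using 3 unfolding q_def by linarith
    ultimately show ?thesis unfolding odd_descent_def by (auto simp: of_bool_def)
  qed
qed

lemma descent_even_block:
  assumes "u \<in> choices p s" "3 \<le> p" "p = 2 * h + 1" "l < p" "2 \<le> j" "j \<le> s"
  shows "descent_at p 1 s (hook_path p 1 s l u) (2 * (1 + j) - 2) \<longleftrightarrow>
         even_descent h (u j) (if j = s then l else u (Suc j))"
proof -
  define P where "P = hook_path p 1 s l u"
  define y where "y = (if j = s then l else u (Suc j))"
  have l: "l < p ^ 1" and uj: "u j < p" and y: "y < p"
    using assms choices_le(1)[of u p s j] choices_le(1)[of u p s "Suc j"]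
    by (auto simp: y_def split: if_splits)
  have L': "Lnum' p 1 s l u j = y + p * u j"
    using Lnum_1[of u p s l j] assms by (simp add: Lnum'_def y_def)
  have d: "(y + p * u j) div p = u j" using y by simp
  note ev = blocks_even[OF assms(1,2) l assms(5,6), unfolded L' d, folded P_def]
  note od = blocks_odd[OF assms(1,2) l assms(5,6), folded P_def]
  have i: "2 * (1 + j) - 2 + 1 = 2 * (1 + j) - 1" "2 * (1 + j) - 2 \<noteq> 2 * 1"
    "2 * 1 + 2 \<le> 2 * (1 + j) - 2" "2 * (1 + j) - 2 \<le> 2 * (1 + s) - 2"
    using assms by auto
  \<comment> \<open>Blocks \<open>2 * j\<close> and \<open>2 * j + 1\<close> have the same size
    \<open>p * (p - 1)\<close>, so the horizontal inequality is equivalent to the vertical one, and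
    only the latter is kept.\<close>
  have "descent_at p 1 s P (2 * (1 + j) - 2) \<longleftrightarrow>
      int y + (int p - 1) * int (u j) < int p * (int p - 1 - int (u j))"
    unfolding descent_at_def i(1) ev od using i by (simp add: algebra_simps)
  also have "\<dots> \<longleftrightarrow> even_descent h (u j) y"
    using even_descent_iff assms uj y by blast
  finally show ?thesis by (simp add: P_def y_def)
qed

text \<open>The block above belongs to index \<open>Suc j\<close>. Hence \<open>j < s\<close>: block
  \<open>2 * s + 1\<close> is the topmost and is compared with nothing.\<close>

lemma descent_odd_block:
  assumes "u \<in> choices p s" "3 \<le> p" "l < p" "2 \<le> j" "j < s"
  shows "descent_at p 1 s (hook_path p 1 s l u) (2 * (1 + j) - 1) \<longleftrightarrow>
         odd_descent p (u j) (u (Suc j)) (if Suc j = s then l else u (Suc (Suc j)))"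
proof -
  define P where "P = hook_path p 1 s l u"
  define z where "z = (if Suc j = s then l else u (Suc (Suc j)))"
  have l: "l < p ^ 1" and uj: "u (Suc j) < p" and z: "z < p"
    using assms choices_le(1)[of u p s "Suc j"] choices_le(1)[of u p s "Suc (Suc j)"]
    by (auto simp: z_def split: if_splits)
  have L': "Lnum' p 1 s l u (Suc j) = z + p * u (Suc j)"
    using Lnum_1[of u p s l "Suc j"] assms by (simp add: Lnum'_def z_def)
  have d: "(z + p * u (Suc j)) div p = u (Suc j)" using z by simp
  have j: "2 \<le> Suc j" "Suc j \<le> s" "j \<le> s" using assms by auto
  note ev = blocks_even[OF assms(1,2) l j(1,2), unfolded L' d, folded P_def]
  note od = blocks_odd[OF assms(1,2) l assms(4) j(3), folded P_def]
  have i: "2 * (1 + j) - 1 + 1 = 2 * (1 + Suc j) - 2" "2 * (1 + j) - 1 \<noteq> 2 * 1"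
    "2 * 1 + 2 \<le> 2 * (1 + j) - 1" "2 * (1 + j) - 1 \<le> 2 * (1 + s) - 2"
    using assms by auto
  have "descent_at p 1 s P (2 * (1 + j) - 1) \<longleftrightarrow>
      int p * (int p - 1 - int (u j)) < int z + (int p - 1) * int (u (Suc j))"
    unfolding descent_at_def i(1) ev od using i by (simp add: algebra_simps)
  also have "\<dots> \<longleftrightarrow> odd_descent p (u j) (u (Suc j)) z"
    using odd_descent_iff uj z by blast
  finally show ?thesis by (simp add: P_def z_def)
qed

lemma descent_bottom_block:
  assumes "u \<in> choices p s" "3 \<le> p" "p = 2 * h + 1" "l < p" "1 \<le> s"
  shows "descent_at p 1 s (hook_path p 1 s l u) 2 \<longleftrightarrow> u 1 < h"
proof -
  have "horiz (hook_path p 1 s l u) (2 * 1 + 1) = int p ^ 1 * int (u 1)"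
    using assms by (intro horiz_bottom) auto
  then show ?thesis using assms(2,3) by (simp add: descent_at_def)
qed

text \<open>Descents can sit only at block 2, at even blocks \<open>2 * j\<close> and at odd blocks
  \<open>2 * j + 1\<close>, both with \<open>2 \<le> j\<close>; these disjoint families are counted
  separately.\<close>

lemma des_hook_path:
  assumes "u \<in> choices p s" "3 \<le> p" "p = 2 * h + 1" "l < p" "1 \<le> s"
  shows "des p 1 s (hook_path p 1 s l u) = of_bool (u 1 < h) +
    (\<Sum>j\<in>{2..s}. of_bool (even_descent h (u j) (if j = s then l else u (Suc j)))) +
    (\<Sum>j\<in>{2..<s}. of_bool (odd_descent p (u j) (u (Suc j)) (if Suc j = s then l else u (Suc (Suc j)))))"
proof -
  define D where "D = descent_at p 1 s (hook_path p 1 s l u)"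
  define A where "A = {i. i = 2 \<and> D i}"
  define B where "B = (\<lambda>j. 2 * (1 + j) - 2) ` {j \<in> {2..s}. D (2 * (1 + j) - 2)}"
  define C where "C = (\<lambda>j. 2 * (1 + j) - 1) ` {j \<in> {2..<s}. D (2 * (1 + j) - 1)}"
  have "i \<in> A \<union> B \<union> C" if "D i" for i
  proof -
    \<comment> \<open>Block \<open>2 * k + 1 = 3\<close> drops out here: below 4 only the
      conventional block 2 can qualify.\<close>
    have range: "i = 2 \<or> 4 \<le> i \<and> i \<le> 2 * s"
      using that unfolding D_def descent_at_def by (auto split: if_splits)
    consider "i = 2" | j where "i = 2 * j" "2 \<le> j" "j \<le> s" | j where "i = 2 * j + 1" "2 \<le> j" "j < s"
    proof (cases "even i")
      case True
      then obtain j where "i = 2 * j" by (rule evenE)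
      then show thesis using range that by (cases "i = 2") auto
    next
      case False
      then obtain j where "i = 2 * j + 1" by (rule oddE)
      then show thesis using range that by auto
    qed
    then show ?thesis
    proof cases
      case (2 j)
      then show ?thesis using \<open>D i\<close> by (auto simp: B_def intro!: image_eqI[of _ _ j])
    next
      case (3 j)
      then show ?thesis using \<open>D i\<close> by (auto simp: C_def intro!: image_eqI[of _ _ j])
    qed (use \<open>D i\<close> in \<open>simp add: A_def\<close>)
  qed
  then have set_eq: "{i. D i} = A \<union> B \<union> C"
    by (auto simp: A_def B_def C_def)
  have fin: "finite A" "finite B" "finite C"
    by (auto simp: A_def B_def C_def)
  have disj: "A \<inter> B = {}" "(A \<union> B) \<inter> C = {}"
    unfolding A_def B_def C_def by (auto, presburger+)
  have "card A = of_bool (u 1 < h)"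
    using descent_bottom_block[OF assms] by (cases "D 2") (auto simp: A_def D_def cong: conj_cong)
  moreover have "card B = (\<Sum>j\<in>{2..s}. of_bool (D (2 * (1 + j) - 2)))"
    unfolding B_def by (subst card_image) (auto simp: inj_on_def Int_def)
  moreover have "card C = (\<Sum>j\<in>{2..<s}. of_bool (D (2 * (1 + j) - 1)))"
    unfolding C_def by (subst card_image) (auto simp: inj_on_def Int_def)
  moreover have "(\<Sum>j\<in>{2..s}. of_bool (D (2 * (1 + j) - 2))) =
    (\<Sum>j\<in>{2..s}. of_bool (even_descent h (u j) (if j = s then l else u (Suc j))) :: nat)"
    unfolding D_def using assms
    by (intro sum.cong refl arg_cong[where f = of_bool] descent_even_block) auto
  moreover have "(\<Sum>j\<in>{2..<s}. of_bool (D (2 * (1 + j) - 1))) =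
    (\<Sum>j\<in>{2..<s}. of_bool (odd_descent p (u j) (u (Suc j))
      (if Suc j = s then l else u (Suc (Suc j)))) :: nat)"
    unfolding D_def using assms
    by (intro sum.cong refl arg_cong[where f = of_bool] descent_odd_block) auto
  ultimately show ?thesis
    using fin disj unfolding des_def D_def[symmetric] set_eq by (simp add: card_Un_disjoint)
qed

text \<open>Distinct choices give distinct paths, so the sum runs over choices and can be exchanged
  with the sum over blocks.\<close>

lemma fib_num_eq_sum_descents:
  assumes "3 \<le> p" "p = 2 * h + 1" "l < p" "1 \<le> s"
  shows "fib_num p 1 s l = (\<Sum>u\<in>choices p s. of_bool (u 1 < h)) +
    (\<Sum>j\<in>{2..s}. \<Sum>u\<in>choices p s.
      of_bool (even_descent h (u j) (if j = s then l else u (Suc j)))) +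
    (\<Sum>j\<in>{2..<s}. \<Sum>u\<in>choices p s.
      of_bool (odd_descent p (u j) (u (Suc j)) (if Suc j = s then l else u (Suc (Suc j)))))"
proof -
  have "inj_on (hook_path p 1 s l) (choices p s)"
    using assms by (intro inj_on_hook_path) auto
  then have "fib_num p 1 s l = (\<Sum>u\<in>choices p s. des p 1 s (hook_path p 1 s l u))"
    by (simp add: fib_num_def hook_paths_def sum.reindex)
  also have "\<dots> = (\<Sum>u\<in>choices p s. of_bool (u 1 < h) +
    (\<Sum>j\<in>{2..s}. of_bool (even_descent h (u j) (if j = s then l else u (Suc j)))) +
    (\<Sum>j\<in>{2..<s}. of_bool (odd_descent p (u j) (u (Suc j)) (if Suc j = s then l else u (Suc (Suc j))))))"
    using assms by (intro sum.cong refl des_hook_path) auto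
  finally show ?thesis
    by (simp only: sum.distrib sum.swap[of _ _ "choices p s"])
qed

section \<open>Counting the digits that produce a descent\<close>

lemma count_even_descent1:
  assumes "p = 2 * h + 1"
  shows "(\<Sum>x<p. of_bool (even_descent h x y)) = (h + of_bool (y < h) :: nat)"
proof -
  have "{..<p} \<inter> {x. even_descent h x y} = (if y < h then {..h} else {..<h})"
    using assms by (auto simp: even_descent_def)
  then show ?thesis by simp
qed

lemma sum_of_bool_less:
  assumes "a \<le> n"
  shows "(\<Sum>x<n. of_bool (x < a)) = (a :: nat)"
proof -
  have "{..<n} \<inter> {x. x < a} = {..<a}" using assms by auto
  then show ?thesis by simp
qed

text \<open>The count is (p^2 - 1) / 2: the pair (h, h) is the middle one of the p^2 pairs in
  lexicographic order.\<close>

lemma count_even_descent2: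
  assumes "p = 2 * h + 1"
  shows "(\<Sum>y<p. \<Sum>x<p. of_bool (even_descent h x y)) = h * (p + 1)"
proof -
  have "(\<Sum>y<p. \<Sum>x<p. of_bool (even_descent h x y)) = (\<Sum>y<p. h + of_bool (y < h))"
    by (simp only: count_even_descent1[OF assms])
  also have "\<dots> = p * h + h"
    unfolding sum.distrib using sum_of_bool_less[of h p] assms by simp
  finally show ?thesis by (simp add: algebra_simps)
qed

lemma count_odd_descent1:
  assumes "y < p" "z < p"
  shows "(\<Sum>x<p. of_bool (odd_descent p x y z)) = (y + of_bool (y < z) :: nat)"
proof -
  have "{..<p} \<inter> {x. odd_descent p x y z} = {p - (y + of_bool (y < z))..<p}"
    using assms by (auto simp: odd_descent_def)
  \<comment> \<open>This makes the interval length \<open>p - (p - n)\<close> collapse to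
    \<open>n\<close>.\<close>
  moreover have "y + of_bool (y < z) \<le> p" using assms by auto
  ultimately show ?thesis by simp
qed

text \<open>The triangular number p(p - 1) / 2 for p = 2h + 1, in a form without division.\<close>

lemma sum_lessThan_odd: "(\<Sum>y<2 * h + 1. y) = (2 * h + 1) * (h :: nat)"
  by (induction h) auto

text \<open>Summing \<open>y\<close> gives \<open>p * h\<close> and summing the tie-breaker gives
  \<open>z\<close>. With \<open>z = t\<close> this is the source of the term linear in
  \<open>t\<close>.\<close>

lemma count_odd_descent2:
  assumes "p = 2 * h + 1" "z < p"
  shows "(\<Sum>y<p. \<Sum>x<p. of_bool (odd_descent p x y z)) = p * h + z"
proof -
  have "(\<Sum>y<p. \<Sum>x<p. of_bool (odd_descent p x y z)) = (\<Sum>y<p. y + of_bool (y < z))"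
    using assms by (intro sum.cong refl count_odd_descent1) auto
  also have "\<dots> = p * h + z"
    unfolding sum.distrib using sum_of_bool_less[of z p] sum_lessThan_odd[of h] assms by simp
  finally show ?thesis .
qed

text \<open>This is \<open>p\<close> times the count of \<open>count_even_descent2\<close>, while
  one coordinate fewer is left free; so odd and even blocks that do not see \<open>t\<close>
  contribute equally.\<close>

lemma count_odd_descent3:
  assumes "p = 2 * h + 1"
  shows "(\<Sum>z<p. \<Sum>y<p. \<Sum>x<p. of_bool (odd_descent p x y z)) = p * (h * (p + 1))"
proof -
  have "(\<Sum>z<p. \<Sum>y<p. \<Sum>x<p. of_bool (odd_descent p x y z)) = (\<Sum>z<p. p * h + z)"
    using assms by (intro sum.cong refl count_odd_descent2) auto
  also have "\<dots> = p * (p * h) + p * h"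
    unfolding sum.distrib using sum_lessThan_odd[of h] assms by simp
  finally show ?thesis by (simp add: algebra_simps)
qed

section \<open>Totals for each family of blocks\<close>

lemma sum_bottom_descents:
  assumes "3 \<le> p" "p = 2 * h + 1" "1 \<le> s"
  shows "(\<Sum>u\<in>choices p s. of_bool (u 1 < h)) = p ^ (s - 1) * h"
  using sum_choices_first[of p s "\<lambda>x. of_bool (x < h)"] sum_of_bool_less[of h "p - 1"] assms by simp

text \<open>The \<open>s - 2\<close> blocks with \<open>j < s\<close> do not see \<open>l\<close>
  and contribute equally; \<open>j = s\<close> sees it only through \<open>l < h\<close>. At
  \<open>s = 2\<close> the truncated exponent \<open>s - 3\<close> is harmless, being multiplied by
  \<open>s - 2 = 0\<close>.\<close>

lemma sum_even_descents:
  assumes "3 \<le> p" "p = 2 * h + 1" "2 \<le> s"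
  shows "(\<Sum>j\<in>{2..s}. \<Sum>u\<in>choices p s.
      of_bool (even_descent h (u j) (if j = s then l else u (Suc j)))) =
    (s - 2) * ((p - 1) * p ^ (s - 3) * (h * (p + 1))) + (p - 1) * p ^ (s - 2) * (h + of_bool (l < h))"
    (is "(\<Sum>j\<in>_. ?f j) = _")
proof -
  have "?f j = (p - 1) * p ^ (s - 3) * (h * (p + 1))" if "j \<in> {2..<s}" for j
    using sum_choices_coord2[of p j s "\<lambda>x y. of_bool (even_descent h x y)"] that assms
      count_even_descent2[OF assms(2)] by simp
  then have "(\<Sum>j\<in>{2..<s}. ?f j) = (s - 2) * ((p - 1) * p ^ (s - 3) * (h * (p + 1)))"
    by simp
  moreover have "?f s = (p - 1) * p ^ (s - 2) * (h + of_bool (l < h))"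
    using sum_choices_coord1[of p s s "\<lambda>x. of_bool (even_descent h x l)"] assms
      count_even_descent1[OF assms(2)] by simp
  moreover have "{2..s} = insert s {2..<s}" using assms by auto
  ultimately show ?thesis by simp
qed

text \<open>Only \<open>j = s - 1\<close> sees \<open>l\<close>; each of the \<open>s - 3\<close>
  lower blocks contributes the same.\<close>

lemma sum_odd_descents:
  assumes "3 \<le> p" "p = 2 * h + 1" "3 \<le> s" "l < p"
  shows "(\<Sum>j\<in>{2..<s}. \<Sum>u\<in>choices p s.
      of_bool (odd_descent p (u j) (u (Suc j)) (if Suc j = s then l else u (Suc (Suc j))))) =
    (s - 3) * ((p - 1) * p ^ (s - 3) * (h * (p + 1))) + (p - 1) * p ^ (s - 3) * (p * h + l)"
    (is "(\<Sum>j\<in>_. ?f j) = _")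
proof -
  have "?f j = (p - 1) * p ^ (s - 3) * (h * (p + 1))" if "j \<in> {2..<s - 1}" for j
  proof -
    have j: "2 \<le> p" "2 \<le> j" "Suc j < s" using that assms by auto
    then have "?f j = (\<Sum>u\<in>choices p s.
        of_bool (odd_descent p (u j) (u (Suc j)) (u (Suc (Suc j)))))"
      by simp
    also have "\<dots> = (p - 1) * p ^ (s - 4) * (p * (h * (p + 1)))"
      unfolding sum_choices_coord3[OF j, of "\<lambda>x y z. of_bool (odd_descent p x y z)"]
        count_odd_descent3[OF assms(2)] ..
    finally have "?f j = (p - 1) * p ^ (s - 4) * (p * (h * (p + 1)))" .
    \<comment> \<open>An index in this range forces \<open>4 \<le> s\<close>; the factor
      \<open>p\<close> of the triple count then raises the exponent to \<open>s - 3\<close>.\<close>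
    moreover have "s - 3 = Suc (s - 4)" using that by auto
    ultimately show ?thesis by simp
  qed
  then have "(\<Sum>j\<in>{2..<s - 1}. ?f j) = (s - 3) * ((p - 1) * p ^ (s - 3) * (h * (p + 1)))"
    by (simp add: numeral_3_eq_3)
  moreover have "?f (s - 1) = (p - 1) * p ^ (s - 3) * (p * h + l)"
    using sum_choices_coord2[of p "s - 1" s "\<lambda>x y. of_bool (odd_descent p x y l)"] assms
      count_odd_descent2[OF assms(2,4)] by simp
  moreover have "(\<Sum>j\<in>{2..<s}. ?f j) = (\<Sum>j\<in>{2..<s - 1}. ?f j) + ?f (s - 1)"
    using sum.atLeastLessThan_Suc[of 2 "s - 1" ?f] assms by simp
  ultimately show ?thesis by (simp only:)
qed

section \<open>The closed formulas\<close>

theorem theorem23: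
  fixes p k r s t :: nat
  assumes "prime p" and "odd p"
    and "k = 1" and "r \<ge> 2" and "s = r - 1"
    and "t \<le> p - 1"
  shows "(s = 1 \<longrightarrow> real (fib_num p k s t) = (real p - 1) / 2) \<and>
    (s = 2 \<longrightarrow> real (fib_num p k s t) =
       (if real t < (real p - 1) / 2
        then (real p - 1) / 2 * (2 * real p + 1)
        else (real p - 1) / 2 * (2 * real p - 1))) \<and>
    (s \<ge> 3 \<longrightarrow> real (fib_num p k s t) =
       (if real t < (real p - 1) / 2
        then real p ^ (s - 3) * (real p - 1) / 2 *
          (2 * (real s - 1) * real p ^ 2 + 2 * real t - (2 * real s - 5))
        else real p ^ (s - 3) * (real p - 1) / 2 *
          (2 * (real s - 1) * real p ^ 2 + 2 * real t - 2 * real p - (2 * real s - 5))))"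
proof -
  obtain h where p: "p = 2 * h + 1" using \<open>odd p\<close> by (rule oddE)
  have "p \<noteq> 1" using \<open>prime p\<close> by auto
  then have p3: "3 \<le> p" and tp: "t < p" using p assms(6) by auto
  have ph: "real p = 2 * real h + 1" and p1: "real (p - 1) = 2 * real h" using p by simp_all
  have th: "real t < (real p - 1) / 2 \<longleftrightarrow> t < h" using ph by simp
  have s1: "1 \<le> s" using assms(4,5) by simp
  note fib = fib_num_eq_sum_descents[OF p3 p tp s1, unfolded sum_bottom_descents[OF p3 p s1]]
  show ?thesis
  proof (intro conjI impI)
    assume "s = 1"
    then show "real (fib_num p k s t) = (real p - 1) / 2"
      using fib ph \<open>k = 1\<close> by simp
  next
    assume s: "s = 2"
    \<comment> \<open>There are no odd blocks here, since \<open>{2..<s}\<close> is empty.\<close>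
    have "fib_num p k s t = p * h + (p - 1) * (h + of_bool (t < h))"
      using fib sum_even_descents[OF p3 p, of s t] s \<open>k = 1\<close> by simp
    then have "real (fib_num p k s t) = real p * h + real (p - 1) * (h + of_bool (t < h))"
      by simp
    then show "real (fib_num p k s t) =
       (if real t < (real p - 1) / 2
        then (real p - 1) / 2 * (2 * real p + 1)
        else (real p - 1) / 2 * (2 * real p - 1))"
      unfolding th unfolding p1 ph by (simp add: algebra_simps)
  next
    assume s: "3 \<le> s"
    \<comment> \<open>Writing \<open>s = a + 3\<close> frees the exponents of truncated
      subtraction.\<close>
    define a where "a = s - 3"
    have a: "s = a + 3" "s - 1 = a + 2" "s - 2 = a + 1" "s - 3 = a" using s by (auto simp: a_def)
    \<comment> \<open>The summands are the bottom block, the even blocks and the odd blocks, in this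
      order.\<close>
    have "fib_num p k s t = p ^ (a + 2) * h +
        ((a + 1) * ((p - 1) * p ^ a * (h * (p + 1))) + (p - 1) * p ^ (a + 1) * (h + of_bool (t < h))) +
        (a * ((p - 1) * p ^ a * (h * (p + 1))) + (p - 1) * p ^ a * (p * h + t))"
      using fib sum_even_descents[OF p3 p, of s t] sum_odd_descents[OF p3 p s tp] s
      unfolding \<open>k = 1\<close> a by simp
    then have "real (fib_num p k s t) = real p ^ (a + 2) * h +
        ((real a + 1) * (real (p - 1) * real p ^ a * (h * (real p + 1))) +
          real (p - 1) * real p ^ (a + 1) * (h + of_bool (t < h))) +
        (a * (real (p - 1) * real p ^ a * (h * (real p + 1))) +
          real (p - 1) * real p ^ a * (real p * h + t))"
      by (simp only: of_nat_add of_nat_mult of_nat_power of_nat_of_bool of_nat_1)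
    also have "\<dots> = real p ^ a * (real p ^ 2 * h +
        ((real a + 1) * (real (p - 1) * (h * (real p + 1))) +
          real (p - 1) * real p * (h + of_bool (t < h))) +
        (a * (real (p - 1) * (h * (real p + 1))) + real (p - 1) * (real p * h + t)))"
      by (simp add: power_add power2_eq_square algebra_simps)
    \<comment> \<open>As 2h = p - 1, the 2a + 1 blocks not seeing \<open>t\<close> give h(2a +
      1)(p^2 - 1). After factoring out h, the two that see it supply 4ph = 2p^2 - 2p, whose -2p is
      cancelled exactly when \<open>t < h\<close>.\<close>
    also have "\<dots> = real p ^ a * ((real p - 1) / 2 *
        (2 * (real s - 1) * real p ^ 2 + 2 * real t - (if t < h then 0 else 2 * real p) -
          (2 * real s - 5)))"
      unfolding p1 unfolding ph a by (simp add: algebra_simps power2_eq_square)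
    finally show "real (fib_num p k s t) =
       (if real t < (real p - 1) / 2
        then real p ^ (s - 3) * (real p - 1) / 2 *
          (2 * (real s - 1) * real p ^ 2 + 2 * real t - (2 * real s - 5))
        else real p ^ (s - 3) * (real p - 1) / 2 *
          (2 * (real s - 1) * real p ^ 2 + 2 * real t - 2 * real p - (2 * real s - 5)))"
      unfolding th a(4) by simp
  qed
qed

end
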